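(* For $d,n\in\mathbf N$ and $\mu\in\mathcal P_n$ one has $$ h_d\, s_\mu=\sum_{\lambda\in\mathcal P_{n+d}}[\mu\leftharpoondown\lambda]\; s_\lambda. $$
   Context: $\mathbf N=\{0,1,2,\ldots\}$. A composition is a finitely supported sequence $\alpha=(\alpha_i)_{i\in\mathbf N}$ of natural numbers; $\mathcal C$ is the set of all compositions, and $|\alpha|=\sum_i\alpha_i$. $\mathcal P_n$ is the set of partitions of $n$: compositions $\lambda$ with $|\lambda|=n$ and $\lambda_i\ge\lambda_{i+1}$ for all $i$. Finite vectors are extended by zeros, so $\mathbf N^n\subset\mathcal C$. The Iverson bracket $[\text{condition}]$ is $1$ if the condition holds and $0$ otherwise. For partitions $\mu,\lambda$, the relation $\mu\leftharpoondown\lambda$ ("$\lambda/\mu$ is a horizontal strip") means that $\lambda_{i+1}\le\mu_i\le\lambda_i$ for all $i\in\mathbf N$. $\Lambda$ is the ring of symmetric functions over $\mathbf Z$ (symmetric power series of bounded degree in indeterminates $X_i$, $i\in\mathbf N$). The complete symmetric function is $h_d=\sum_{i_1\le\cdots\le i_d}X_{i_1}\cdots X_{i_d}\in\Lambda$ (so $h_0=1$). Schur functions: for $\alpha\in\mathbf N^n$ put $a_\alpha[X_{[n]}]=\sum_{\sigma\in\mathbf S_n}\operatorname{sgn}(\sigma)\prod_{i=0}^{n-1}X_{\sigma(i)}^{\alpha_i}$, let $\delta_n=(n-1,\ldots,1,0)$, and set $s_\alpha[X_{[n]}]=a_{\delta_n+\alpha}[X_{[n]}]/a_{\delta_n}[X_{[n]}]$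 for $\alpha\in\mathbf N^n$ and $s_\alpha[X_{[n]}]=0$ for $\alpha\in\mathcal C\setminus\mathbf N^n$. Then $s_\alpha\in\Lambda$ is the unique symmetric function which for every $n\in\mathbf N$ becomes $s_\alpha[X_{[n]}]$ upon setting $X_i=0$ for all $i\ge n$. *)

theory Defs
  imports "HOL-Library.Poly_Mapping" "HOL-Library.Multiset" "HOL-Combinatorics.Permutations"
begin

section \<open>Compositions and partitions\<close>

type_synonym composition = "nat \<Rightarrow>\<^sub>0 nat"

definition weight :: "composition \<Rightarrow> nat" where
  "weight \<alpha> = (\<Sum>i\<in>Poly_Mapping.keys \<alpha>. Poly_Mapping.lookup \<alpha> i)"

text \<open>The set of compositions that are vectors of length \<open>n\<close> extended by zeros.\<close>

definition vectors :: "nat \<Rightarrow> composition set" where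
  "vectors n = {\<alpha>. Poly_Mapping.keys \<alpha> \<subseteq> {..<n}}"

definition partitions :: "nat \<Rightarrow> composition set" where
  "partitions n = {\<nu>. weight \<nu> = n \<and>
     (\<forall>i. Poly_Mapping.lookup \<nu> (Suc i) \<le> Poly_Mapping.lookup \<nu> i)}"

definition horizontal_strip :: "composition \<Rightarrow> composition \<Rightarrow> bool" where
  "horizontal_strip \<mu> \<nu> \<longleftrightarrow>
     (\<forall>i. Poly_Mapping.lookup \<nu> (Suc i) \<le> Poly_Mapping.lookup \<mu> i \<and>
       Poly_Mapping.lookup \<mu> i \<le> Poly_Mapping.lookup \<nu> i)"


section \<open>Power series over the integers in indeterminates indexed by the naturals\<close>

text \<open>A monomial is identified with its exponent vector, which is again a finitely supported
  sequence of naturals.\<close>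

typedef power_series = "UNIV :: (composition \<Rightarrow> int) set"
  morphisms ps_coeff Power_Series ..

lemma ps_coeff_Power_Series [simp]: "ps_coeff (Power_Series f) = f"
  by (simp add: Power_Series_inverse)

lemma power_series_eqI: "(\<And>m. ps_coeff f m = ps_coeff g m) \<Longrightarrow> f = g"
  by (metis ext ps_coeff_inject)

definition splits :: "composition \<Rightarrow> (composition \<times> composition) set" where
  "splits m = {(a, b). a + b = m}"

lemma finite_pointwise_le: "finite {a :: composition. \<forall>i. Poly_Mapping.lookup a i \<le> Poly_Mapping.lookup m i}"
proof -
  let ?A = "{a :: composition. \<forall>i. Poly_Mapping.lookup a i \<le> Poly_Mapping.lookup m i}"
  let ?F = "{f. \<forall>i. (i \<in> Poly_Mapping.keys m \<longrightarrow> f i \<in> {..weight m}) \<and>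
      (i \<notin> Poly_Mapping.keys m \<longrightarrow> f i = (0::nat))}"
  have "Poly_Mapping.lookup ` ?A \<subseteq> ?F"
  proof clarsimp
    fix a :: composition and i
    assume le: "\<forall>i. Poly_Mapping.lookup a i \<le> Poly_Mapping.lookup m i"
    have "Poly_Mapping.lookup m i \<le> weight m" if "i \<in> Poly_Mapping.keys m"
      unfolding weight_def by (rule member_le_sum) (use that in auto)
    then show "(i \<in> Poly_Mapping.keys m \<longrightarrow> Poly_Mapping.lookup a i \<le> weight m) \<and>
      (i \<notin> Poly_Mapping.keys m \<longrightarrow> Poly_Mapping.lookup a i = 0)"
      using le by (metis le_trans le_zero_eq not_in_keys_iff_lookup_eq_zero)
  qed
  moreover have "finite ?F"
    by (rule finite_set_of_finite_funs) auto
  ultimately have "finite (Poly_Mapping.lookup ` ?A)"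
    by (rule finite_subset)
  then show ?thesis
    by (rule finite_imageD) (auto simp: inj_on_def poly_mapping_eqI)
qed

lemma finite_splits [simp]: "finite (splits m)"
proof -
  have "splits m \<subseteq> {a. \<forall>i. Poly_Mapping.lookup a i \<le> Poly_Mapping.lookup m i} \<times>
    {a. \<forall>i. Poly_Mapping.lookup a i \<le> Poly_Mapping.lookup m i}"
    by (auto simp: splits_def lookup_add)
  then show ?thesis
    using finite_pointwise_le finite_subset by blast
qed

instantiation power_series :: comm_ring_1
begin

definition zero_power_series :: power_series where
  "0 = Power_Series (\<lambda>m. 0)"

definition one_power_series :: power_series where
  "1 = Power_Series (\<lambda>m. of_bool (m = 0))"

definition plus_power_series :: "power_series \<Rightarrow> power_series \<Rightarrow> power_series" where
  "f + g = Power_Series (\<lambda>m. ps_coeff f m + ps_coeff g m)"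

definition uminus_power_series :: "power_series \<Rightarrow> power_series" where
  "- f = Power_Series (\<lambda>m. - ps_coeff f m)"

definition minus_power_series :: "power_series \<Rightarrow> power_series \<Rightarrow> power_series" where
  "f - g = Power_Series (\<lambda>m. ps_coeff f m - ps_coeff g m)"

definition times_power_series :: "power_series \<Rightarrow> power_series \<Rightarrow> power_series" where
  "f * g = Power_Series (\<lambda>m. \<Sum>(a, b)\<in>splits m. ps_coeff f a * ps_coeff g b)"

instance
proof
  fix f g h :: power_series
  show "f * g * h = f * (g * h)"
  proof (rule power_series_eqI)
    fix m
    have "ps_coeff (f * g * h) m =
      (\<Sum>(p, c)\<in>splits m. \<Sum>(a, b)\<in>splits p. ps_coeff f a * ps_coeff g b * ps_coeff h c)"
      by (simp add: times_power_series_def sum_distrib_right case_prod_unfold)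
    also have "\<dots> = (\<Sum>((p, c), (a, b))\<in>Sigma (splits m) (\<lambda>(p, c). splits p).
        ps_coeff f a * ps_coeff g b * ps_coeff h c)"
      by (simp add: sum.Sigma case_prod_unfold)
    also have "\<dots> = (\<Sum>((a, q), (b, c))\<in>Sigma (splits m) (\<lambda>(a, q). splits q).
        ps_coeff f a * ps_coeff g b * ps_coeff h c)"
      by (rule sum.reindex_bij_witness
          [where i = "\<lambda>((a, q), (b, c)). ((a + b, c), (a, b))"
            and j = "\<lambda>((p, c), (a, b)). ((a, b + c), (b, c))"])
        (auto simp: splits_def add.assoc)
    also have "\<dots> =
      (\<Sum>(a, q)\<in>splits m. \<Sum>(b, c)\<in>splits q. ps_coeff f a * ps_coeff g b * ps_coeff h c)"
      by (simp add: sum.Sigma case_prod_unfold)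
    also have "\<dots> = ps_coeff (f * (g * h)) m"
      by (simp add: times_power_series_def sum_distrib_left case_prod_unfold mult.assoc)
    finally show "ps_coeff (f * g * h) m = ps_coeff (f * (g * h)) m" .
  qed
  show "f * g = g * f"
  proof (rule power_series_eqI)
    fix m
    show "ps_coeff (f * g) m = ps_coeff (g * f) m"
      unfolding times_power_series_def ps_coeff_Power_Series
      by (rule sum.reindex_bij_witness[where i = prod.swap and j = prod.swap])
        (auto simp: splits_def add.commute)
  qed
  show "1 * f = f"
  proof (rule power_series_eqI)
    fix m
    have "ps_coeff (1 * f) m = (\<Sum>(a, b)\<in>splits m. of_bool (a = 0) * ps_coeff f b)"
      by (simp add: times_power_series_def one_power_series_def)
    also have "\<dots> = (\<Sum>(a, b)\<in>{(0 :: composition, m)}. of_bool (a = 0) * ps_coeff f b)"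
      by (rule sum.mono_neutral_right[OF finite_splits]) (auto simp: splits_def)
    finally show "ps_coeff (1 * f) m = ps_coeff f m"
      by simp
  qed
  show "(f + g) * h = f * h + g * h"
    by (rule power_series_eqI)
      (simp add: times_power_series_def plus_power_series_def distrib_right sum.distrib
        case_prod_unfold)
  have "ps_coeff 0 0 \<noteq> ps_coeff 1 0"
    by (simp add: zero_power_series_def one_power_series_def)
  then show "(0 :: power_series) \<noteq> 1"
    by metis
qed (auto intro!: power_series_eqI simp: zero_power_series_def plus_power_series_def
      uminus_power_series_def minus_power_series_def)

end

text \<open>Setting \<open>X\<^sub>i = 0\<close> for all \<open>i \<ge> n\<close>.\<close>

definition restrict_vars :: "nat \<Rightarrow> power_series \<Rightarrow> power_series" where
  "restrict_vars n f = Power_Series (\<lambda>m. if m \<in> vectors n then ps_coeff f m else 0)"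


section \<open>Symmetric functions\<close>

text \<open>For a bijection \<open>\<sigma>\<close>, the sequence \<^term>\<open>Poly_Mapping.map_key \<sigma> m\<close> is
  \<open>i \<mapsto> Poly_Mapping.lookup m (\<sigma> i)\<close>.\<close>

definition symmetric_functions :: "power_series set" where
  "symmetric_functions =
     {f. (\<forall>\<sigma> m. bij \<sigma> \<longrightarrow> ps_coeff f (Poly_Mapping.map_key \<sigma> m) = ps_coeff f m) \<and>
         (\<exists>D. \<forall>m. ps_coeff f m \<noteq> 0 \<longrightarrow> weight m \<le> D)}"

text \<open>The infinite sum of the monomials \<open>X\<^bsub>i\<^sub>1\<^esub> \<cdots> X\<^bsub>i\<^sub>d\<^esub>\<close>: the coefficient at \<open>m\<close> counts
  the sequences \<open>i\<^sub>1 \<le> \<dots> \<le> i\<^sub>d\<close> for which this monomial has exponent vector \<open>m\<close>.\<close>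

definition complete_symmetric :: "nat \<Rightarrow> power_series" where
  "complete_symmetric d = Power_Series (\<lambda>m.
     int (card {is. length is = d \<and> sorted is \<and> (\<Sum>i\<leftarrow>is. Poly_Mapping.single i 1) = m}))"


section \<open>Schur functions\<close>

type_synonym polynomial = "composition \<Rightarrow>\<^sub>0 int"

definition var :: "nat \<Rightarrow> polynomial" where
  "var i = Poly_Mapping.single (Poly_Mapping.single i 1) 1"

definition alternant :: "nat \<Rightarrow> composition \<Rightarrow> polynomial" where
  "alternant n \<alpha> =
     (\<Sum>\<sigma> | \<sigma> permutes {..<n}. of_int (sign \<sigma>) * (\<Prod>i<n. var (\<sigma> i) ^ Poly_Mapping.lookup \<alpha> i))"

definition staircase :: "nat \<Rightarrow> composition" where
  "staircase n = (\<Sum>i<n. Poly_Mapping.single i (n - Suc i))"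

text \<open>The quotient of alternants is the polynomial \<open>q\<close> below; it is unique because
  polynomials form an integral domain.\<close>

definition schur_polynomial :: "nat \<Rightarrow> composition \<Rightarrow> polynomial" where
  "schur_polynomial n \<alpha> =
     (if \<alpha> \<in> vectors n
      then (THE q. q * alternant n (staircase n) = alternant n (staircase n + \<alpha>))
      else 0)"

definition schur :: "composition \<Rightarrow> power_series" where
  "schur \<alpha> = (THE f. f \<in> symmetric_functions \<and>
     (\<forall>n. restrict_vars n f = Power_Series (Poly_Mapping.lookup (schur_polynomial n \<alpha>))))"


section \<open>Finiteness and the coefficients of complete symmetric functions\<close>

text \<open>These facts ensure that the cardinality above and sums over partitions do not take
  the default value for infinite sets.\<close>

lemma weight_add: "weight (a + b) = weight a + weight b"
proof -
  have *: "weight c = (\<Sum>i\<in>Poly_Mapping.keys a \<union> Poly_Mapping.keys b. Poly_Mapping.lookup c i)"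
    if "Poly_Mapping.keys c \<subseteq> Poly_Mapping.keys a \<union> Poly_Mapping.keys b" for c
    unfolding weight_def
    by (rule sum.mono_neutral_left) (use that in \<open>auto simp: in_keys_iff\<close>)
  show ?thesis
    using keys_add[of a b] by (simp add: * lookup_add sum.distrib)
qed

lemma weight_single [simp]: "weight (Poly_Mapping.single i k) = k"
  by (cases "k = 0") (auto simp: weight_def)

lemma weight_sum_list_single: "weight (\<Sum>i\<leftarrow>is. Poly_Mapping.single i 1) = length is"
proof (induction "is")
  case Nil
  show ?case by (simp add: weight_def)
qed (simp add: weight_add)

lemma lookup_sum_list_single:
  "Poly_Mapping.lookup (\<Sum>i\<leftarrow>is. Poly_Mapping.single i (1::nat)) j = count (mset is) j"
  by (induction "is") (auto simp: lookup_add lookup_single)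

lemma ps_coeff_complete_symmetric:
  "ps_coeff (complete_symmetric d) m = of_bool (weight m = d)"
proof -
  define M where "M = Abs_multiset (Poly_Mapping.lookup m)"
  have count_M: "count M = Poly_Mapping.lookup m"
    unfolding M_def by (rule Abs_multiset_inverse) (use finite_lookup[of m] in simp)
  have eq_iff: "(\<Sum>i\<leftarrow>is. Poly_Mapping.single i 1) = m \<longleftrightarrow> mset is = M" for "is"
    by (metis count_M lookup_sum_list_single multiset_eqI poly_mapping_eqI)
  define js where "js = sorted_list_of_multiset M"
  have js: "mset js = M" "sorted js"
    by (simp_all add: js_def)
  have len: "length js = weight m"
    using eq_iff[of js] js weight_sum_list_single[of js] by simp
  have "{is. length is = d \<and> sorted is \<and> (\<Sum>i\<leftarrow>is. Poly_Mapping.single i 1) = m} =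
      (if weight m = d then {js} else {})"
  proof -
    have "length is = d \<and> sorted is \<and> mset is = M \<longleftrightarrow> weight m = d \<and> is = js" for "is"
      using js len by (metis properties_for_sort)
    then show ?thesis
      unfolding eq_iff by simp
  qed
  then show ?thesis
    by (simp add: complete_symmetric_def)
qed

lemma finite_partitions: "finite (partitions n)"
proof -
  have *: "Poly_Mapping.lookup \<nu> i \<le> n \<and> (i \<ge> n \<longrightarrow> Poly_Mapping.lookup \<nu> i = 0)"
    if "\<nu> \<in> partitions n" for \<nu> i
  proof -
    have w: "weight \<nu> = n" and step: "\<And>i. Poly_Mapping.lookup \<nu> (Suc i) \<le> Poly_Mapping.lookup \<nu> i"
      using that by (simp_all add: partitions_def)
    have dec: "Poly_Mapping.lookup \<nu> j \<le> Poly_Mapping.lookup \<nu> i" if "i \<le> j" for i j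
      using step that by (rule lift_Suc_antimono_le)
    have "Poly_Mapping.lookup \<nu> i \<le> n"
    proof (cases "i \<in> Poly_Mapping.keys \<nu>")
      case True
      then show ?thesis
        unfolding w[symmetric] weight_def by (intro member_le_sum) auto
    qed (simp add: in_keys_iff)
    moreover have "Poly_Mapping.lookup \<nu> i = 0" if "i \<ge> n"
    proof (rule ccontr)
      assume nz: "Poly_Mapping.lookup \<nu> i \<noteq> 0"
      have pos: "Poly_Mapping.lookup \<nu> j \<ge> 1" if "j \<le> i" for j
        using dec[OF that] nz by simp
      have "i + 1 = (\<Sum>j\<le>i. 1)" by simp
      also have "\<dots> \<le> (\<Sum>j\<le>i. Poly_Mapping.lookup \<nu> j)"
        by (rule sum_mono) (use pos in auto)
      also have "\<dots> \<le> weight \<nu>"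
        unfolding weight_def using pos by (intro sum_mono2) (auto simp: in_keys_iff Suc_le_eq)
      finally show False using w that by simp
    qed
    ultimately show ?thesis by simp
  qed
  let ?F = "{f. \<forall>i. (i \<in> {..<n} \<longrightarrow> f i \<in> {..n}) \<and> (i \<notin> {..<n} \<longrightarrow> f i = (0::nat))}"
  have "Poly_Mapping.lookup ` partitions n \<subseteq> ?F"
    using * by (auto simp: not_less)
  moreover have "finite ?F"
    by (rule finite_set_of_finite_funs) auto
  ultimately have "finite (Poly_Mapping.lookup ` partitions n)"
    by (rule finite_subset)
  then show ?thesis
    by (rule finite_imageD) (auto simp: inj_on_def poly_mapping_eqI)
qed

end

theory Submission
  imports Defs
begin

text \<open>Multiplying \<open>a\<^bsub>\<delta>+\<mu>\<^esub>\<close> by \<open>h\<^sub>d\<close> in \<open>n\<close> variables gives the sum of all \<open>a\<^bsub>\<delta>+\<nu>\<^esub>\<close> with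
  \<open>\<nu> \<ge> \<mu>\<close> and \<open>|\<nu>| = |\<mu>| + d\<close>. If \<open>\<nu>/\<mu>\<close> is not a horizontal strip, take the largest \<open>i\<close> with
  \<open>\<nu>\<^bsub>i+1\<^esub> > \<mu>\<^sub>i\<close>: swapping the entries \<open>i\<close> and \<open>i + 1\<close> of \<open>\<delta> + \<nu>\<close> is an involution
  on these \<open>\<nu>\<close> that negates the alternant, so their contributions cancel. This identity of alternants
  also yields, by recursion on the last row, symmetric functions whose products with \<open>a\<^sub>\<delta>\<close> are the
  alternants \<open>a\<^bsub>\<delta>+\<lambda>\<^esub>\<close> in every number of variables; hence Schur functions exist, and the rule
  follows on cancelling \<open>a\<^sub>\<delta>\<close>.\<close>

abbreviation (input) lookup where "lookup \<equiv> Poly_Mapping.lookup"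

section \<open>Compositions\<close>

lemma in_vectors_iff: "\<alpha> \<in> vectors n \<longleftrightarrow> (\<forall>i\<ge>n. lookup \<alpha> i = 0)"
  by (auto simp: vectors_def in_keys_iff subset_iff simp flip: not_less)

lemma in_some_vectors: obtains n where "\<alpha> \<in> vectors n"
  using finite_keys[of \<alpha>] by (auto simp: vectors_def finite_nat_set_iff_bounded)

lemma add_in_vectors_iff: "\<alpha> + \<beta> \<in> vectors n \<longleftrightarrow> \<alpha> \<in> vectors n \<and> \<beta> \<in> vectors n"
  by (auto simp: in_vectors_iff lookup_add)

lemma lookup_staircase: "lookup (staircase n) i = n - Suc i"
  by (simp add: staircase_def lookup_sum lookup_single when_def)

lemma staircase_in_vectors: "staircase n \<in> vectors n"
  by (simp add: in_vectors_iff lookup_staircase)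

lemma lookup_map_key: "bij \<sigma> \<Longrightarrow> lookup (Poly_Mapping.map_key \<sigma> m) i = lookup m (\<sigma> i)"
  by (simp add: map_key.rep_eq bij_is_inj)

lemma weight_map_key:
  assumes "bij \<sigma>"
  shows "weight (Poly_Mapping.map_key \<sigma> m) = weight m"
proof -
  have k: "Poly_Mapping.keys m = \<sigma> ` Poly_Mapping.keys (Poly_Mapping.map_key \<sigma> m)"
    using assms by (simp add: keys_map_key bij_is_inj bij_is_surj surj_image_vimage_eq)
  show ?thesis
    unfolding weight_def k using assms
    by (simp add: sum.reindex inj_on_subset[OF bij_is_inj] lookup_map_key)
qed

lemma map_key_inv_cancel:
  assumes "bij \<sigma>"
  shows "Poly_Mapping.map_key \<sigma> (Poly_Mapping.map_key (inv \<sigma>) m) = m"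
    and "Poly_Mapping.map_key (inv \<sigma>) (Poly_Mapping.map_key \<sigma> m) = m"
  using assms
  by (auto intro!: poly_mapping_eqI simp: lookup_map_key bij_imp_bij_inv bij_is_inj bij_is_surj
      surj_f_inv_f)

lemma map_key_in_vectors:
  assumes "\<sigma> permutes {..<n}" "m \<in> vectors n"
  shows "Poly_Mapping.map_key \<sigma> m \<in> vectors n"
  using assms permutes_not_in[OF assms(1)]
  by (auto simp: in_vectors_iff lookup_map_key permutes_bij)

text \<open>Domination makes the truncated difference \<beta> - \<alpha> exact; its weight is 0, so
  it vanishes.\<close>

lemma composition_le_weight_eq:
  assumes "\<And>i. lookup \<alpha> i \<le> lookup \<beta> i" "weight \<alpha> = weight \<beta>"
  shows "\<alpha> = \<beta>"
proof -
  have b: "\<beta> = \<alpha> + (\<beta> - \<alpha>)"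
    using assms(1) by (intro poly_mapping_eqI) (simp add: lookup_add lookup_minus)
  then have "weight \<beta> = weight \<alpha> + weight (\<beta> - \<alpha>)"
    by (metis weight_add)
  then have "weight (\<beta> - \<alpha>) = 0" using assms(2) by simp
  then have "lookup (\<beta> - \<alpha>) i = 0" for i
    by (auto simp: weight_def in_keys_iff)
  then show ?thesis using b by (metis poly_mapping_eqI add.right_neutral lookup_zero)
qed

text \<open>Every such \<open>m\<close> lies entrywise below the vector with \<open>n\<close>
  entries \<open>D\<close>. Bounded degree in finitely many variables thus leaves finitely many
  monomials.\<close>

lemma finite_vectors_weight_le: "finite {m \<in> vectors n. weight m \<le> D}"
proof (rule finite_subset[OF _ finite_pointwise_le[of "\<Sum>i<n. Poly_Mapping.single i D"]])
  have "lookup m i \<le> weight m" for m :: composition and i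
    by (cases "i \<in> Poly_Mapping.keys m")
      (auto simp: weight_def in_keys_iff intro: member_le_sum)
  moreover have "lookup (\<Sum>i<n. Poly_Mapping.single i D) i = (if i < n then D else 0)" for i
    by (simp add: lookup_sum lookup_single when_def)
  ultimately show "{m \<in> vectors n. weight m \<le> D} \<subseteq>
      {a. \<forall>i. lookup a i \<le> lookup (\<Sum>i<n. Poly_Mapping.single i D) i}"
    by (auto simp: in_vectors_iff intro: le_trans)
qed


section \<open>Alternants\<close>

lemma prod_single_1:
  "finite A \<Longrightarrow> (\<Prod>i\<in>A. Poly_Mapping.single (f i) 1) =
     (Poly_Mapping.single (\<Sum>i\<in>A. f i :: composition) 1 :: polynomial)"
  by (induction A rule: finite_induct) (auto simp: mult_single)

lemma var_power: "var i ^ k = Poly_Mapping.single (Poly_Mapping.single i k) 1"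
  by (induction k) (auto simp: var_def mult_single simp flip: single_add)

text \<open>In the product for \<sigma>, the variable with index \<open>j\<close> receives the
  exponent of \<alpha> at \<open>inv \<sigma> j\<close>. The defining product only sees the first
  \<open>n\<close> entries of \<alpha>, whence the hypothesis.\<close>

lemma alternant_eq:
  assumes "\<alpha> \<in> vectors n"
  shows "alternant n \<alpha> = (\<Sum>\<sigma> | \<sigma> permutes {..<n}.
    of_int (sign \<sigma>) * Poly_Mapping.single (Poly_Mapping.map_key (inv \<sigma>) \<alpha>) 1)"
  unfolding alternant_def
proof (rule sum.cong[OF refl])
  fix \<sigma> assume "\<sigma> \<in> {\<sigma>. \<sigma> permutes {..<n}}"
  then have s: "\<sigma> permutes {..<n}" by simp
  have "(\<Sum>i<n. Poly_Mapping.single (\<sigma> i) (lookup \<alpha> i)) = Poly_Mapping.map_key (inv \<sigma>) \<alpha>"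
  proof (rule poly_mapping_eqI)
    fix j
    have "lookup (\<Sum>i<n. Poly_Mapping.single (\<sigma> i) (lookup \<alpha> i)) j
      = (\<Sum>i<n. if i = inv \<sigma> j then lookup \<alpha> i else 0)"
      unfolding lookup_sum lookup_single when_def
      by (intro sum.cong) (auto simp: permutes_inverses[OF s])
    also have "\<dots> = lookup \<alpha> (inv \<sigma> j)"
      using assms by (auto simp: in_vectors_iff)
    finally show "lookup (\<Sum>i<n. Poly_Mapping.single (\<sigma> i) (lookup \<alpha> i)) j =
      lookup (Poly_Mapping.map_key (inv \<sigma>) \<alpha>) j"
      using s by (simp add: lookup_map_key permutes_bij bij_imp_bij_inv)
  qed
  then show "of_int (sign \<sigma>) * (\<Prod>i<n. var (\<sigma> i) ^ lookup \<alpha> i) =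
     of_int (sign \<sigma>) * Poly_Mapping.single (Poly_Mapping.map_key (inv \<sigma>) \<alpha>) 1"
    by (simp add: var_power prod_single_1)
qed

lemma lookup_of_int_sign_mult: "lookup (of_int (sign \<sigma>) * p :: polynomial) m = sign \<sigma> * lookup p m"
  by (simp add: sign_def)

text \<open>The first \<open>n\<close> entries of the staircase are distinct, so only the identity
  contributes to the coefficient at \<open>staircase n\<close>, which is therefore 1.\<close>

lemma alternant_staircase_nonzero: "alternant n (staircase n) \<noteq> 0"
proof -
  have "lookup (alternant n (staircase n)) (staircase n) =
    (\<Sum>\<sigma> | \<sigma> permutes {..<n}. if \<sigma> = id then 1 else 0)"
    unfolding alternant_eq[OF staircase_in_vectors] lookup_sum
  proof (rule sum.cong[OF refl])
    fix \<sigma> assume "\<sigma> \<in> {\<sigma>. \<sigma> permutes {..<n}}"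
    then have s: "\<sigma> permutes {..<n}" by simp
    have "\<sigma> = id" if eq: "Poly_Mapping.map_key (inv \<sigma>) (staircase n) = staircase n"
    proof -
      have "inv \<sigma> i = i" for i
      proof (cases "i < n")
        case True
        then have "inv \<sigma> i < n" using permutes_in_image[OF permutes_inv[OF s], of i] by simp
        \<comment> \<open>This truncated subtraction determines the index because both indices are
          below \<open>n\<close>.\<close>
        moreover have "n - Suc (inv \<sigma> i) = n - Suc i"
          using arg_cong[OF eq, of "\<lambda>m. lookup m i"] s
          by (simp add: lookup_map_key permutes_bij bij_imp_bij_inv lookup_staircase)
        ultimately show ?thesis using True by simp
      next
        case False
        then show ?thesis using permutes_not_in[OF permutes_inv[OF s]] by simp
      qed
      then show ?thesis using s by (metis permutes_inverses(1) eq_id_iff)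
    qed
    moreover have "Poly_Mapping.map_key (inv id) (staircase n) = staircase n"
      by (rule poly_mapping_eqI) (simp add: lookup_map_key)
    ultimately show "lookup (of_int (sign \<sigma>) *
        Poly_Mapping.single (Poly_Mapping.map_key (inv \<sigma>) (staircase n)) (1::int)) (staircase n) =
        (if \<sigma> = id then 1 else 0)"
      by (auto simp: lookup_of_int_sign_mult lookup_single when_def)
  qed
  also have "\<dots> = 1"
    by (simp add: finite_permutations)
  finally show ?thesis by auto
qed

text \<open>Precomposing the summation index \<sigma> with the transposition flips the sign of every
  term.\<close>

lemma alternant_transpose:
  assumes "\<alpha> \<in> vectors n" "i < n" "j < n" "i \<noteq> j"
  shows "alternant n (Poly_Mapping.map_key (transpose i j) \<alpha>) = - alternant n \<alpha>"
proof -
  let ?\<tau> = "transpose i j"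
  have t: "?\<tau> permutes {..<n}" using assms by (simp add: permutes_swap_id)
  have "alternant n \<alpha> = (\<Sum>\<sigma> | \<sigma> permutes {..<n}.
    of_int (sign (\<sigma> \<circ> ?\<tau>)) * Poly_Mapping.single (Poly_Mapping.map_key (inv (\<sigma> \<circ> ?\<tau>)) \<alpha>) 1)"
    unfolding alternant_eq[OF assms(1)] by (rule sum_permutations_compose_right[OF t])
  also have "\<dots> = (\<Sum>\<sigma> | \<sigma> permutes {..<n}. - (of_int (sign \<sigma>) *
      Poly_Mapping.single (Poly_Mapping.map_key (inv \<sigma>) (Poly_Mapping.map_key ?\<tau> \<alpha>)) 1))"
  proof (rule sum.cong[OF refl])
    fix \<sigma> assume "\<sigma> \<in> {\<sigma>. \<sigma> permutes {..<n}}"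
    then have s: "\<sigma> permutes {..<n}" by simp
    have "sign (\<sigma> \<circ> ?\<tau>) = - sign \<sigma>"
      using s t assms(4)
      by (subst sign_compose) (auto simp: sign_swap_id intro: permutation_permutes[THEN iffD2])
    moreover have "inv (\<sigma> \<circ> ?\<tau>) = ?\<tau> \<circ> inv \<sigma>"
      using s t by (simp add: o_inv_distrib permutes_bij)
    ultimately show "of_int (sign (\<sigma> \<circ> ?\<tau>)) *
        Poly_Mapping.single (Poly_Mapping.map_key (inv (\<sigma> \<circ> ?\<tau>)) \<alpha>) 1 = - (of_int (sign \<sigma>) *
      Poly_Mapping.single (Poly_Mapping.map_key (inv \<sigma>) (Poly_Mapping.map_key ?\<tau> \<alpha>)) 1 :: polynomial)"
      using s by (simp add: map_key_compose permutes_inj permutes_bij bij_imp_bij_inv bij_is_inj)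
  qed
  also have "\<dots> = - alternant n (Poly_Mapping.map_key ?\<tau> \<alpha>)"
    by (simp add: alternant_eq[OF map_key_in_vectors[OF t assms(1)]] sum_negf)
  finally show ?thesis by simp
qed

section \<open>Products of alternants with complete symmetric polynomials in \<open>n\<close>
  variables\<close>

definition complete_polynomial :: "nat \<Rightarrow> nat \<Rightarrow> polynomial" where
  "complete_polynomial n d = (\<Sum>\<beta> | \<beta> \<in> vectors n \<and> weight \<beta> = d. Poly_Mapping.single \<beta> 1)"

lemma finite_vectors_weight_eq: "finite {m \<in> vectors n. weight m = D}"
  by (rule finite_subset[OF _ finite_vectors_weight_le[of n D]]) auto

text \<open>For fixed \<sigma>, permuting entries maps the set of exponents \<beta> bijectively to
  itself. Hence \<sigma> may be made to act on \<beta> along with \<gamma>, which turns the product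
  into alternants of \<gamma> + \<beta>.\<close>

lemma complete_polynomial_mult_alternant:
  assumes "\<gamma> \<in> vectors n"
  shows "complete_polynomial n d * alternant n \<gamma> =
    (\<Sum>\<beta> | \<beta> \<in> vectors n \<and> weight \<beta> = d. alternant n (\<gamma> + \<beta>))"
proof -
  let ?B = "{\<beta> \<in> vectors n. weight \<beta> = d}"
  have *: "Poly_Mapping.single \<beta> 1 * (of_int s * Poly_Mapping.single \<alpha> 1) =
      of_int s * (Poly_Mapping.single (\<alpha> + \<beta>) 1 :: polynomial)" for s :: int and \<alpha> \<beta>
    by (metis mult.left_commute mult_single mult_1 add.commute)
  have "complete_polynomial n d * alternant n \<gamma> = (\<Sum>\<sigma> | \<sigma> permutes {..<n}. \<Sum>\<beta>\<in>?B.
      of_int (sign \<sigma>) * Poly_Mapping.single (Poly_Mapping.map_key (inv \<sigma>) \<gamma> + \<beta>) 1)"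
    unfolding complete_polynomial_def alternant_eq[OF assms] sum_product *
    by (rule sum.swap)
  also have "\<dots> = (\<Sum>\<sigma> | \<sigma> permutes {..<n}. \<Sum>\<beta>\<in>?B.
      of_int (sign \<sigma>) * Poly_Mapping.single (Poly_Mapping.map_key (inv \<sigma>) (\<gamma> + \<beta>)) 1)"
  proof (rule sum.cong[OF refl])
    fix \<sigma> assume "\<sigma> \<in> {\<sigma>. \<sigma> permutes {..<n}}"
    then have s: "\<sigma> permutes {..<n}" by simp
    have b: "bij \<sigma>" "bij (inv \<sigma>)" using s by (auto intro: permutes_bij permutes_inv)
    have "bij_betw (Poly_Mapping.map_key (inv \<sigma>)) ?B ?B"
      by (rule bij_betw_byWitness[where f' = "Poly_Mapping.map_key \<sigma>"])
        (simp_all add: map_key_inv_cancel b image_subset_iff weight_map_key map_key_in_vectors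
          s permutes_inv)
    then show "(\<Sum>\<beta>\<in>?B. of_int (sign \<sigma>) *
        Poly_Mapping.single (Poly_Mapping.map_key (inv \<sigma>) \<gamma> + \<beta>) 1) =
      (\<Sum>\<beta>\<in>?B. of_int (sign \<sigma>) *
        Poly_Mapping.single (Poly_Mapping.map_key (inv \<sigma>) (\<gamma> + \<beta>)) (1::int))"
      unfolding map_key_plus[OF bij_is_inj[OF b(2)]] by (rule sum.reindex_bij_betw[symmetric])
  qed
  also have "\<dots> = (\<Sum>\<beta>\<in>?B. alternant n (\<gamma> + \<beta>))"
    by (rule trans[OF sum.swap], rule sum.cong[OF refl])
      (use assms in \<open>simp add: alternant_eq add_in_vectors_iff\<close>)
  finally show ?thesis .
qed

lemma sum_alternant_mult_complete:
  assumes "\<mu> \<in> partitions k" "\<mu> \<in> vectors n"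
  shows "complete_polynomial n d * alternant n (staircase n + \<mu>) =
    (\<Sum>\<nu> | \<nu> \<in> vectors n \<and> weight \<nu> = k + d \<and> (\<forall>i. lookup \<mu> i \<le> lookup \<nu> i).
      alternant n (staircase n + \<nu>))"
proof -
  have w: "weight \<mu> = k" using assms by (simp add: partitions_def)
  \<comment> \<open>Subtraction of naturals truncates; it inverts \<beta> \<mapsto> \<mu> + \<beta>
    exactly on the \<nu> dominating \<mu>.\<close>
  have inv: "\<nu> = \<mu> + (\<nu> - \<mu>)" if "\<forall>i. lookup \<mu> i \<le> lookup \<nu> i" for \<nu> :: composition
    using that by (intro poly_mapping_eqI) (simp add: lookup_add lookup_minus)
  have diff: "\<nu> - \<mu> \<in> vectors n \<and> weight (\<nu> - \<mu>) = d"
    if "\<nu> \<in> vectors n" "weight \<nu> = k + d" "\<forall>i. lookup \<mu> i \<le> lookup \<nu> i" for \<nu>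
    using that inv[of \<nu>] w by (metis add_in_vectors_iff weight_add add_left_cancel)
  have "staircase n + \<mu> \<in> vectors n"
    using assms by (simp add: add_in_vectors_iff staircase_in_vectors)
  note complete_polynomial_mult_alternant[OF this, of d]
  also have "(\<Sum>\<beta> | \<beta> \<in> vectors n \<and> weight \<beta> = d. alternant n (staircase n + \<mu> + \<beta>)) =
    (\<Sum>\<nu> | \<nu> \<in> vectors n \<and> weight \<nu> = k + d \<and> (\<forall>i. lookup \<mu> i \<le> lookup \<nu> i).
      alternant n (staircase n + \<nu>))"
    by (rule sum.reindex_bij_witness[where i = "\<lambda>\<nu>. \<nu> - \<mu>" and j = "\<lambda>\<beta>. \<mu> + \<beta>"])
      (use assms w diff inv in \<open>auto simp: add_in_vectors_iff weight_add lookup_add add.assoc\<close>)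
  finally show ?thesis .
qed

text \<open>The swap uses the last violation of the strip condition: later entries do not change,
  so the same position is found again.\<close>

lemma sum_alternant_non_strip:
  assumes "\<mu> \<in> partitions k"
  shows "(\<Sum>\<nu> | \<nu> \<in> vectors n \<and> weight \<nu> = w \<and> (\<forall>i. lookup \<mu> i \<le> lookup \<nu> i) \<and>
      (\<exists>i. lookup \<mu> i < lookup \<nu> (Suc i)). alternant n (staircase n + \<nu>)) = 0"
    (is "sum ?f ?N = 0")
proof -
  \<comment> \<open>For \<nu> in \<open>?N\<close> this set is finite and nonempty, so the maximum
    is meaningful.\<close>
  define p where "p \<nu> = Max {i. lookup \<mu> i < lookup \<nu> (Suc i)}" for \<nu> :: composition
  define T where "T \<nu> = Poly_Mapping.map_key (transpose (p \<nu>) (Suc (p \<nu>))) (staircase n + \<nu>)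
    - staircase n" for \<nu>
  have p_props: "lookup \<mu> (p \<nu>) < lookup \<nu> (Suc (p \<nu>))"
      "\<And>j. p \<nu> < j \<Longrightarrow> lookup \<nu> (Suc j) \<le> lookup \<mu> j" "Suc (p \<nu>) < n"
    if "\<nu> \<in> ?N" for \<nu>
  proof -
    let ?S = "{i. lookup \<mu> i < lookup \<nu> (Suc i)}"
    \<comment> \<open>A violation at \<open>i\<close> makes the entry of \<nu> at
      \<open>Suc i\<close> positive.\<close>
    have *: "Suc i < n" if "lookup \<mu> i < lookup \<nu> (Suc i)" for i
      using that \<open>\<nu> \<in> ?N\<close> by (auto simp: in_vectors_iff not_le[symmetric])
    have fin: "finite ?S"
      by (rule finite_subset[of _ "{..<n}"]) (auto dest: *)
    have "p \<nu> \<in> ?S"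
      unfolding p_def using that by (intro Max_in fin) auto
    then show "lookup \<mu> (p \<nu>) < lookup \<nu> (Suc (p \<nu>))" "Suc (p \<nu>) < n"
      using * by auto
    show "lookup \<nu> (Suc j) \<le> lookup \<mu> j" if "p \<nu> < j" for j
      using that Max_ge[OF fin, of j] by (force simp: p_def not_le[symmetric])
  qed
  have T_add: "staircase n + T \<nu> =
      Poly_Mapping.map_key (transpose (p \<nu>) (Suc (p \<nu>))) (staircase n + \<nu>)"
    and lookup_T: "lookup (T \<nu>) j = (if j = p \<nu> then lookup \<nu> (Suc (p \<nu>)) - 1
      else if j = Suc (p \<nu>) then lookup \<nu> (p \<nu>) + 1 else lookup \<nu> j)"
    if "\<nu> \<in> ?N" for \<nu> j
  proof -
    \<comment> \<open>This difference of 1 is the source of the \<open>- 1\<close> and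
      \<open>+ 1\<close> in \<open>lookup_T\<close>. The \<open>- 1\<close> does not truncate, since
      the violation makes that entry of \<nu> positive.\<close>
    have step: "lookup (staircase n) (p \<nu>) = Suc (lookup (staircase n) (Suc (p \<nu>)))"
      using p_props(3)[OF that] by (simp add: lookup_staircase)
    show lT: "lookup (T \<nu>) j = (if j = p \<nu> then lookup \<nu> (Suc (p \<nu>)) - 1
      else if j = Suc (p \<nu>) then lookup \<nu> (p \<nu>) + 1 else lookup \<nu> j)" for j
      using step by (simp add: T_def lookup_minus lookup_add lookup_map_key transpose_def)
    show "staircase n + T \<nu> =
      Poly_Mapping.map_key (transpose (p \<nu>) (Suc (p \<nu>))) (staircase n + \<nu>)"
      by (rule poly_mapping_eqI)
        (use step p_props(1)[OF that] in \<open>auto simp: lookup_add lT lookup_map_key transpose_def\<close>)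
  qed
  have T_N: "T \<nu> \<in> ?N" and p_T: "p (T \<nu>) = p \<nu>" if N: "\<nu> \<in> ?N" for \<nu>
  proof -
    note P = p_props[OF N]
    have perm: "transpose (p \<nu>) (Suc (p \<nu>)) permutes {..<n}"
      using P(3) by (intro permutes_swap_id) auto
    have "staircase n + \<nu> \<in> vectors n"
      using N by (simp add: add_in_vectors_iff staircase_in_vectors)
    then have v: "T \<nu> \<in> vectors n"
      using map_key_in_vectors[OF perm] by (metis T_add[OF N] add_in_vectors_iff)
    have "weight (staircase n) + weight (T \<nu>) = weight (staircase n) + weight \<nu>"
      by (metis T_add[OF N] weight_add weight_map_key bij_transpose)
    then have wt: "weight (T \<nu>) = w" using N by simp
    have ge: "lookup \<mu> i \<le> lookup \<nu> i" for i using N by auto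
    \<comment> \<open>Both changed entries of \<open>T \<nu>\<close> are at least the entry of \<mu>
      at \<open>p \<nu>\<close>. Since \<mu> decreases, this also bounds the entry at
      \<open>Suc (p \<nu>)\<close>.\<close>
    have "lookup \<mu> (Suc (p \<nu>)) \<le> lookup \<mu> (p \<nu>)"
      using assms by (simp add: partitions_def)
    then have geT: "lookup \<mu> i \<le> lookup (T \<nu>) i" for i
      using ge[of i] ge[of "p \<nu>"] P(1) by (auto simp: lookup_T[OF N])
    \<comment> \<open>The violation at \<open>p \<nu>\<close> survives, because the new entry
      exceeds the old entry of \<nu> at \<open>p \<nu>\<close> by 1.\<close>
    have bad: "lookup \<mu> (p \<nu>) < lookup (T \<nu>) (Suc (p \<nu>))"
      using ge[of "p \<nu>"] by (simp add: lookup_T[OF N])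
    with v wt geT show TN: "T \<nu> \<in> ?N" by auto
    show "p (T \<nu>) = p \<nu>"
    proof (rule linorder_cases[of "p (T \<nu>)" "p \<nu>"])
      assume "p (T \<nu>) < p \<nu>"
      then show ?thesis using p_props(2)[OF TN] bad by (metis not_le)
    next
      \<comment> \<open>\<open>T\<close> leaves all entries beyond \<open>Suc (p \<nu>)\<close>
        alone, so it creates no later violation.\<close>
      assume "p \<nu> < p (T \<nu>)"
      then show ?thesis
        using P(2)[of "p (T \<nu>)"] p_props(1)[OF TN] by (simp add: lookup_T[OF N])
    qed
  qed
  have TT: "T (T \<nu>) = \<nu>" if "\<nu> \<in> ?N" for \<nu>
  proof -
    have "T (T \<nu>) = Poly_Mapping.map_key (transpose (p \<nu>) (Suc (p \<nu>))) (staircase n + T \<nu>) - staircase n"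
      by (simp add: T_def[of "T \<nu>"] p_T[OF that])
    also have "\<dots> = \<nu>"
      unfolding T_add[OF that]
      by (rule poly_mapping_eqI) (simp add: lookup_minus lookup_map_key lookup_add)
    finally show ?thesis .
  qed
  have fT: "?f (T \<nu>) = - ?f \<nu>" if "\<nu> \<in> ?N" for \<nu>
    unfolding T_add[OF that] using that p_props(3)[OF that]
    by (intro alternant_transpose) (auto simp: add_in_vectors_iff staircase_in_vectors)
  have "bij_betw T ?N ?N"
    by (rule bij_betw_byWitness[where f' = T]) (use TT T_N in blast)+
  then have "sum ?f ?N = (\<Sum>\<nu>\<in>?N. ?f (T \<nu>))"
    by (rule sum.reindex_bij_betw[symmetric])
  also have "\<dots> = (\<Sum>\<nu>\<in>?N. - ?f \<nu>)"
    by (rule sum.cong[OF refl fT])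
  also have "\<dots> = - sum ?f ?N" by (rule sum_negf)
  finally have eq: "sum ?f ?N = - sum ?f ?N" .
  \<comment> \<open>Each coefficient of the sum is an integer equal to its own negative.\<close>
  show ?thesis
    using arg_cong[OF eq, of "\<lambda>q. lookup q m" for m]
    by (intro poly_mapping_eqI) (simp only: lookup_uminus lookup_zero equal_neg_zero)
qed

lemma pieri_alternant:
  assumes "\<mu> \<in> partitions k" "\<mu> \<in> vectors n"
  shows "complete_polynomial n d * alternant n (staircase n + \<mu>) =
    (\<Sum>\<nu> | \<nu> \<in> partitions (k + d) \<and> horizontal_strip \<mu> \<nu> \<and> \<nu> \<in> vectors n.
      alternant n (staircase n + \<nu>))"
proof -
  let ?f = "\<lambda>\<nu>. alternant n (staircase n + \<nu>)"
  let ?N = "{\<nu>. \<nu> \<in> vectors n \<and> weight \<nu> = k + d \<and> (\<forall>i. lookup \<mu> i \<le> lookup \<nu> i)}"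
  let ?B = "{\<nu>. \<nu> \<in> vectors n \<and> weight \<nu> = k + d \<and> (\<forall>i. lookup \<mu> i \<le> lookup \<nu> i) \<and>
      (\<exists>i. lookup \<mu> i < lookup \<nu> (Suc i))}"
  have fin: "finite ?N"
    by (rule finite_subset[OF _ finite_vectors_weight_eq[of n "k + d"]]) auto
  \<comment> \<open>Without a violation, each entry of \<mu> lies between consecutive entries of
    \<nu>; so \<nu> decreases as well.\<close>
  have "?N - ?B = {\<nu>. \<nu> \<in> partitions (k + d) \<and> horizontal_strip \<mu> \<nu> \<and> \<nu> \<in> vectors n}"
    by (simp add: partitions_def horizontal_strip_def set_eq_iff) (meson le_trans not_le)
  moreover have "sum ?f ?N = sum ?f (?N - ?B) + sum ?f ?B"
    by (rule sum.subset_diff) (use fin in auto)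
  ultimately show ?thesis
    using sum_alternant_mult_complete[OF assms, of d] sum_alternant_non_strip[OF assms(1), of n "k + d"]
    by simp
qed


section \<open>Polynomials as power series\<close>

text \<open>The embedding that occurs unfolded in the definition of \<open>schur\<close>; it carries
  polynomial identities over to power series.\<close>

definition ps_of_poly :: "polynomial \<Rightarrow> power_series" where
  "ps_of_poly q = Power_Series (lookup q)"

lemma ps_coeff_ps_of_poly [simp]: "ps_coeff (ps_of_poly q) m = lookup q m"
  by (simp add: ps_of_poly_def)

lemma ps_of_poly_eq_iff: "ps_of_poly p = ps_of_poly q \<longleftrightarrow> p = q"
  by (metis poly_mapping_eqI ps_coeff_ps_of_poly)

lemma ps_coeff_add [simp]: "ps_coeff (f + g) m = ps_coeff f m + ps_coeff g m"
  and ps_coeff_diff [simp]: "ps_coeff (f - g) m = ps_coeff f m - ps_coeff g m"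
  and ps_coeff_zero [simp]: "ps_coeff 0 m = 0"
  and ps_coeff_mult: "ps_coeff (f * g) m = (\<Sum>(a, b)\<in>splits m. ps_coeff f a * ps_coeff g b)"
  by (simp_all add: plus_power_series_def minus_power_series_def zero_power_series_def
      times_power_series_def)

lemma ps_of_poly_eq_0_iff: "ps_of_poly p = 0 \<longleftrightarrow> p = 0"
  by (metis poly_mapping_eqI power_series_eqI ps_coeff_ps_of_poly ps_coeff_zero lookup_zero)

lemma ps_coeff_sum: "ps_coeff (sum f A) m = (\<Sum>x\<in>A. ps_coeff (f x) m)"
  by (induction A rule: infinite_finite_induct) auto

lemma ps_of_poly_mult: "ps_of_poly (p * q) = ps_of_poly p * ps_of_poly q"
proof (rule power_series_eqI)
  fix m
  have "lookup (p * q) m = (\<Sum>(a, b). lookup p a * lookup q b when m = a + b)"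
    unfolding times_poly_mapping.rep_eq by (rule prod_fun_unfold_prod) simp_all
  also have "\<dots> = (\<Sum>(a, b)\<in>splits m. lookup p a * lookup q b when m = a + b)"
    by (rule Sum_any.expand_superset[OF finite_splits]) (auto simp: splits_def)
  also have "\<dots> = (\<Sum>(a, b)\<in>splits m. lookup p a * lookup q b)"
    by (rule sum.cong) (auto simp: splits_def)
  finally show "ps_coeff (ps_of_poly (p * q)) m = ps_coeff (ps_of_poly p * ps_of_poly q) m"
    by (simp add: ps_coeff_mult)
qed

lemma ps_of_poly_sum: "ps_of_poly (sum f A) = (\<Sum>x\<in>A. ps_of_poly (f x))"
  by (rule power_series_eqI) (simp add: ps_coeff_sum lookup_sum)

lemma ps_coeff_restrict_vars:
  "ps_coeff (restrict_vars n f) m = (if m \<in> vectors n then ps_coeff f m else 0)"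
  by (simp add: restrict_vars_def)

lemma restrict_vars_diff: "restrict_vars n (f - g) = restrict_vars n f - restrict_vars n g"
  by (rule power_series_eqI) (simp add: ps_coeff_restrict_vars)

lemma restrict_vars_sum: "restrict_vars n (sum f A) = (\<Sum>x\<in>A. restrict_vars n (f x))"
  by (rule power_series_eqI) (simp add: ps_coeff_restrict_vars ps_coeff_sum)

text \<open>Exponents cannot cancel: a product of monomials avoids the variables set to zero exactly
  if both factors do.\<close>

lemma restrict_vars_mult: "restrict_vars n (f * g) = restrict_vars n f * restrict_vars n g"
proof (rule power_series_eqI)
  fix m
  show "ps_coeff (restrict_vars n (f * g)) m = ps_coeff (restrict_vars n f * restrict_vars n g) m"
  proof (cases "m \<in> vectors n")
    case True
    then have "a \<in> vectors n \<and> b \<in> vectors n" if "(a, b) \<in> splits m" for a b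
      using that by (auto simp: splits_def add_in_vectors_iff)
    then show ?thesis
      using True by (auto simp: ps_coeff_restrict_vars ps_coeff_mult intro!: sum.cong)
  next
    case False
    then have "a \<notin> vectors n \<or> b \<notin> vectors n" if "(a, b) \<in> splits m" for a b
      using that by (auto simp: splits_def add_in_vectors_iff)
    then show ?thesis
      using False by (auto simp: ps_coeff_restrict_vars ps_coeff_mult intro!: sum.neutral)
  qed
qed

text \<open>Each single monomial involves finitely many variables, so it survives some
  restriction.\<close>

lemma restrict_vars_inject:
  assumes "\<And>n. restrict_vars n f = restrict_vars n g"
  shows "f = g"
proof (rule power_series_eqI)
  fix m
  obtain n where "m \<in> vectors n" by (rule in_some_vectors)
  then show "ps_coeff f m = ps_coeff g m"
    using assms[of n] by (metis ps_coeff_restrict_vars)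
qed

lemma restrict_vars_complete_symmetric:
  "restrict_vars n (complete_symmetric d) = ps_of_poly (complete_polynomial n d)"
proof (rule power_series_eqI)
  fix m
  have "lookup (complete_polynomial n d) m = (if m \<in> vectors n \<and> weight m = d then 1 else 0)"
    unfolding complete_polynomial_def lookup_sum lookup_single when_def
    using finite_vectors_weight_eq[of n d] by simp
  then show "ps_coeff (restrict_vars n (complete_symmetric d)) m =
    ps_coeff (ps_of_poly (complete_polynomial n d)) m"
    by (simp add: ps_coeff_restrict_vars ps_coeff_complete_symmetric)
qed


section \<open>Symmetric functions\<close>

lemma symmetric_functionsI:
  assumes "\<And>\<sigma> m. bij \<sigma> \<Longrightarrow> ps_coeff f (Poly_Mapping.map_key \<sigma> m) = ps_coeff f m"
    and "\<And>m. ps_coeff f m \<noteq> 0 \<Longrightarrow> weight m \<le> D"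
  shows "f \<in> symmetric_functions"
  using assms by (auto simp: symmetric_functions_def)

lemma symmetric_functionsE:
  assumes "f \<in> symmetric_functions"
  obtains D where "\<And>\<sigma> m. bij \<sigma> \<Longrightarrow> ps_coeff f (Poly_Mapping.map_key \<sigma> m) = ps_coeff f m"
    and "\<And>m. ps_coeff f m \<noteq> 0 \<Longrightarrow> weight m \<le> D"
  using assms by (auto simp: symmetric_functions_def)

lemma complete_symmetric_symmetric: "complete_symmetric d \<in> symmetric_functions"
  by (rule symmetric_functionsI[where D = d])
    (auto simp: ps_coeff_complete_symmetric weight_map_key)

lemma zero_symmetric: "0 \<in> symmetric_functions"
  by (rule symmetric_functionsI[where D = 0]) auto

lemma one_symmetric: "1 \<in> symmetric_functions"
proof (rule symmetric_functionsI[where D = 0])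
  \<comment> \<open>Expressing the constant monomial through its weight makes its invariance under
    permutations evident.\<close>
  have z: "m = 0 \<longleftrightarrow> weight m = 0" for m :: composition
    by (auto simp: weight_def in_keys_iff intro: poly_mapping_eqI)
  show "ps_coeff 1 (Poly_Mapping.map_key \<sigma> m) = ps_coeff 1 m" if "bij \<sigma>" for \<sigma> m
    unfolding one_power_series_def ps_coeff_Power_Series z weight_map_key[OF that] ..
  show "weight m \<le> 0" if "ps_coeff 1 m \<noteq> 0" for m
    using that by (simp add: one_power_series_def weight_def split: if_splits)
qed

lemma add_symmetric:
  assumes "f \<in> symmetric_functions" "g \<in> symmetric_functions"
  shows "f + g \<in> symmetric_functions"
proof -
  from assms obtain D E where "\<And>m. ps_coeff f m \<noteq> 0 \<Longrightarrow> weight m \<le> D"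
    "\<And>m. ps_coeff g m \<noteq> 0 \<Longrightarrow> weight m \<le> E"
    by (metis symmetric_functionsE)
  then have "weight m \<le> max D E" if "ps_coeff (f + g) m \<noteq> 0" for m
    using that by (cases "ps_coeff f m = 0") (auto simp: le_max_iff_disj)
  then show ?thesis
    by (rule symmetric_functionsI[rotated])
      (use assms in \<open>auto elim!: symmetric_functionsE\<close>)
qed

lemma diff_symmetric:
  assumes "f \<in> symmetric_functions" "g \<in> symmetric_functions"
  shows "f - g \<in> symmetric_functions"
proof -
  from assms obtain D E where "\<And>m. ps_coeff f m \<noteq> 0 \<Longrightarrow> weight m \<le> D"
    "\<And>m. ps_coeff g m \<noteq> 0 \<Longrightarrow> weight m \<le> E"
    by (metis symmetric_functionsE)
  then have "weight m \<le> max D E" if "ps_coeff (f - g) m \<noteq> 0" for m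
    using that by (cases "ps_coeff f m = 0") (auto simp: le_max_iff_disj)
  then show ?thesis
    by (rule symmetric_functionsI[rotated])
      (use assms in \<open>auto elim!: symmetric_functionsE\<close>)
qed

lemma sum_symmetric:
  "(\<And>x. x \<in> A \<Longrightarrow> f x \<in> symmetric_functions) \<Longrightarrow> sum f A \<in> symmetric_functions"
  by (induction A rule: infinite_finite_induct) (auto intro: zero_symmetric add_symmetric)

text \<open>Permuting variables maps the splittings of a monomial bijectively onto those of the
  permuted monomial; degree bounds add.\<close>

lemma mult_symmetric:
  assumes "f \<in> symmetric_functions" "g \<in> symmetric_functions"
  shows "f * g \<in> symmetric_functions"
proof -
  from assms obtain D E where f: "\<And>\<sigma> m. bij \<sigma> \<Longrightarrow> ps_coeff f (Poly_Mapping.map_key \<sigma> m) = ps_coeff f m"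
      "\<And>m. ps_coeff f m \<noteq> 0 \<Longrightarrow> weight m \<le> D"
    and g: "\<And>\<sigma> m. bij \<sigma> \<Longrightarrow> ps_coeff g (Poly_Mapping.map_key \<sigma> m) = ps_coeff g m"
      "\<And>m. ps_coeff g m \<noteq> 0 \<Longrightarrow> weight m \<le> E"
    by (elim symmetric_functionsE) blast
  show ?thesis
  proof (rule symmetric_functionsI[where D = "D + E"])
    fix \<sigma> :: "nat \<Rightarrow> nat" and m :: composition
    assume s: "bij \<sigma>"
    note s' = bij_imp_bij_inv[OF s]
    let ?h = "\<lambda>\<tau> (a, b). (Poly_Mapping.map_key \<tau> a, Poly_Mapping.map_key \<tau> b) :: composition \<times> composition"
    have "bij_betw (?h \<sigma>) (splits m) (splits (Poly_Mapping.map_key \<sigma> m))"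
      by (rule bij_betw_byWitness[where f' = "?h (inv \<sigma>)"])
        (auto simp: splits_def map_key_inv_cancel s
          map_key_plus[OF bij_is_inj[OF s], symmetric] map_key_plus[OF bij_is_inj[OF s'], symmetric])
    then show "ps_coeff (f * g) (Poly_Mapping.map_key \<sigma> m) = ps_coeff (f * g) m"
      unfolding ps_coeff_mult
      by (rule trans[OF sum.reindex_bij_betw[symmetric]])
        (auto intro!: sum.cong simp: f g s)
  next
    fix m assume "ps_coeff (f * g) m \<noteq> 0"
    then obtain a b where "a + b = m" "ps_coeff f a \<noteq> 0" "ps_coeff g b \<noteq> 0"
      unfolding ps_coeff_mult
      by (elim sum.not_neutral_contains_not_neutral) (auto simp: splits_def)
    then show "weight m \<le> D + E"
      using f(2)[of a] g(2)[of b] by (auto simp: weight_add)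
  qed
qed

section \<open>Symmetric functions restricted to finitely many variables\<close>

lemma restrict_vars_symmetric_polynomial:
  assumes "f \<in> symmetric_functions"
  obtains q where "restrict_vars n f = ps_of_poly q"
proof -
  obtain D where "\<And>m. ps_coeff f m \<noteq> 0 \<Longrightarrow> weight m \<le> D"
    using assms by (auto simp: symmetric_functions_def)
  then have "finite {m. ps_coeff (restrict_vars n f) m \<noteq> 0}"
    by (intro finite_subset[OF _ finite_vectors_weight_le[of n D]])
      (auto simp: ps_coeff_restrict_vars split: if_splits)
  then have "restrict_vars n f = ps_of_poly (Poly_Mapping.Abs_poly_mapping (ps_coeff (restrict_vars n f)))"
    by (intro power_series_eqI) simp
  then show thesis by (rule that)
qed

text \<open>Bounded degree turns both restrictions into polynomials, which form an integral domain;
  the cancellation takes place there.\<close>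

lemma restrict_vars_cancel_alternant:
  assumes "f \<in> symmetric_functions" "g \<in> symmetric_functions"
    and "restrict_vars n f * ps_of_poly (alternant n (staircase n)) =
      restrict_vars n g * ps_of_poly (alternant n (staircase n))"
  shows "restrict_vars n f = restrict_vars n g"
proof -
  obtain p q where pq: "restrict_vars n f = ps_of_poly p" "restrict_vars n g = ps_of_poly q"
    using assms(1,2) by (meson restrict_vars_symmetric_polynomial)
  then have "p * alternant n (staircase n) = q * alternant n (staircase n)"
    using assms(3) by (simp flip: ps_of_poly_mult add: ps_of_poly_eq_iff)
  then show ?thesis
    using pq alternant_staircase_nonzero by simp
qed


section \<open>Schur functions\<close>

text \<open>The value 0 encodes the convention that \<open>s_\<alpha>\<close> vanishes in
  \<open>n\<close> variables when \<alpha> is not a vector of length \<open>n\<close>.\<close>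

definition schur_numerator :: "nat \<Rightarrow> composition \<Rightarrow> power_series" where
  "schur_numerator n \<alpha> =
     (if \<alpha> \<in> vectors n then ps_of_poly (alternant n (staircase n + \<alpha>)) else 0)"

text \<open>A characterization of \<open>s_\<alpha>\<close> free of division and of definite
  descriptions.\<close>

definition is_schur :: "composition \<Rightarrow> power_series \<Rightarrow> bool" where
  "is_schur \<alpha> f \<longleftrightarrow> f \<in> symmetric_functions \<and>
     (\<forall>n. restrict_vars n f * ps_of_poly (alternant n (staircase n)) = schur_numerator n \<alpha>)"

text \<open>The zero convention makes the index set independent of \<open>n\<close>. If \<mu> has
  too many rows, so does every \<nu> containing it, and both sides vanish.\<close>

lemma pieri_schur_numerator:
  assumes "\<mu> \<in> partitions k"
  shows "restrict_vars n (complete_symmetric d) * schur_numerator n \<mu> =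
    (\<Sum>\<nu> | \<nu> \<in> partitions (k + d) \<and> horizontal_strip \<mu> \<nu>. schur_numerator n \<nu>)"
proof (cases "\<mu> \<in> vectors n")
  case True
  have "restrict_vars n (complete_symmetric d) * schur_numerator n \<mu> =
    ps_of_poly (complete_polynomial n d * alternant n (staircase n + \<mu>))"
    using True by (simp add: restrict_vars_complete_symmetric schur_numerator_def ps_of_poly_mult)
  also have "\<dots> = (\<Sum>\<nu> | \<nu> \<in> partitions (k + d) \<and> horizontal_strip \<mu> \<nu> \<and> \<nu> \<in> vectors n.
      schur_numerator n \<nu>)"
    by (simp add: pieri_alternant[OF assms True] ps_of_poly_sum schur_numerator_def)
  also have "\<dots> = (\<Sum>\<nu> | \<nu> \<in> partitions (k + d) \<and> horizontal_strip \<mu> \<nu>. schur_numerator n \<nu>)"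
    by (rule sum.mono_neutral_left) (auto simp: schur_numerator_def finite_partitions)
  finally show ?thesis .
next
  case False
  have "\<nu> \<notin> vectors n" if "horizontal_strip \<mu> \<nu>" for \<nu>
    using False that unfolding in_vectors_iff horizontal_strip_def by (metis le_zero_eq)
  then show ?thesis
    using False by (auto simp: schur_numerator_def intro!: sum.neutral[symmetric])
qed

section \<open>Uniqueness and existence of Schur functions\<close>

text \<open>Both descriptions in the definition of \<open>schur\<close> have unique solutions: the
  quotient because \<open>a_\<delta>\<close> is cancellable, the series because its restrictions
  determine it.\<close>

lemma is_schur_schur:
  assumes "is_schur \<alpha> f"
  shows "schur \<alpha> = f"
proof -
  have f: "f \<in> symmetric_functions" using assms by (simp add: is_schur_def)
  have r: "restrict_vars n f = Power_Series (lookup (schur_polynomial n \<alpha>))" for n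
  proof -
    obtain q where q: "restrict_vars n f = ps_of_poly q"
      using f by (rule restrict_vars_symmetric_polynomial)
    have "ps_of_poly (q * alternant n (staircase n)) = schur_numerator n \<alpha>"
      using assms by (simp add: is_schur_def ps_of_poly_mult flip: q)
    then have eq: "q * alternant n (staircase n) =
        (if \<alpha> \<in> vectors n then alternant n (staircase n + \<alpha>) else 0)"
      by (simp add: schur_numerator_def ps_of_poly_eq_iff ps_of_poly_eq_0_iff split: if_splits)
    have "schur_polynomial n \<alpha> = q"
    proof (cases "\<alpha> \<in> vectors n")
      case True
      have "(THE q. q * alternant n (staircase n) = alternant n (staircase n + \<alpha>)) = q"
      proof (rule the_equality)
        show "q * alternant n (staircase n) = alternant n (staircase n + \<alpha>)"
          using eq True by simp
        then show "p = q" if "p * alternant n (staircase n) = alternant n (staircase n + \<alpha>)" for p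
          using that alternant_staircase_nonzero by (metis mult_right_cancel)
      qed
      then show ?thesis using True by (simp add: schur_polynomial_def)
    next
      \<comment> \<open>Here \<open>q\<close> times a nonzero polynomial is 0, so \<open>q\<close>
        agrees with the default value 0 of \<open>schur_polynomial\<close>.\<close>
      case False
      then show ?thesis using eq alternant_staircase_nonzero by (simp add: schur_polynomial_def)
    qed
    then show ?thesis using q by (simp add: ps_of_poly_def)
  qed
  show ?thesis
    unfolding schur_def using f r by (intro the_equality) (auto intro: restrict_vars_inject)
qed

text \<open>Splitting off the last row \<open>d\<close> of \<open>\<lambda>\<close> leaves a partition \<open>\<mu>\<close>, and among the \<open>\<nu>\<close> in
  \<open>h\<^sub>d s\<^sub>\<mu>\<close> the last row is shorter than \<open>d\<close> except for \<open>\<nu> = \<lambda>\<close>; this determines \<open>s\<^sub>\<lambda>\<close> recursively.\<close>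

lemma is_schur_exists_vectors:
  assumes "\<alpha> \<in> partitions k" "\<alpha> \<in> vectors r"
  shows "\<exists>f. is_schur \<alpha> f"
  using assms
proof (induction r arbitrary: k \<alpha>)
  case 0
  then have \<alpha>: "\<alpha> = 0"
    by (auto simp: in_vectors_iff intro: poly_mapping_eqI)
  have "restrict_vars n 1 = 1" for n
    by (rule power_series_eqI)
      (auto simp: ps_coeff_restrict_vars one_power_series_def in_vectors_iff)
  \<comment> \<open>For the empty partition, numerator and denominator coincide.\<close>
  then have "is_schur \<alpha> 1"
    by (simp add: is_schur_def one_symmetric schur_numerator_def \<alpha> in_vectors_iff)
  then show ?case ..
next
  case (Suc r)
  from Suc.prems show ?case
  \<comment> \<open>The outer hypothesis supplies the Schur function of \<mu>; the inner one, on the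
    length of row \<open>r\<close>, those of the remaining \<nu>.\<close>
  proof (induction "lookup \<alpha> r" arbitrary: k \<alpha> rule: less_induct)
    case less
    define d where "d = lookup \<alpha> r"
    define \<mu> where "\<mu> = \<alpha> - Poly_Mapping.single r d"
    have lookup_\<mu>: "lookup \<mu> i = (if i < r then lookup \<alpha> i else 0)" for i
      using less.prems(2)
      by (auto simp: \<mu>_def d_def lookup_minus lookup_single when_def in_vectors_iff not_less)
    have \<alpha>_eq: "\<alpha> = \<mu> + Poly_Mapping.single r d"
      by (rule poly_mapping_eqI)
        (auto simp: \<mu>_def d_def lookup_add lookup_minus lookup_single when_def)
    have dec: "lookup \<alpha> (Suc i) \<le> lookup \<alpha> i" for i
      using less.prems(1) by (simp add: partitions_def)
    define l where "l = weight \<mu>"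
    have k: "k = l + d"
      using less.prems(1) arg_cong[OF \<alpha>_eq, of weight]
      by (simp add: partitions_def l_def weight_add)
    have \<mu>: "\<mu> \<in> partitions l" "\<mu> \<in> vectors r"
      using dec by (auto simp: partitions_def l_def lookup_\<mu> in_vectors_iff)
    then obtain g where g: "is_schur \<mu> g" using Suc.IH by blast
    let ?S = "{\<nu>. \<nu> \<in> partitions (l + d) \<and> horizontal_strip \<mu> \<nu>}"
    have fin: "finite ?S" by (simp add: finite_partitions)
    have \<alpha>S: "\<alpha> \<in> ?S"
      using less.prems dec k
      by (auto simp: horizontal_strip_def lookup_\<mu> in_vectors_iff)
    have "\<exists>f. is_schur \<nu> f" if \<nu>: "\<nu> \<in> ?S - {\<alpha>}" for \<nu>
    proof (rule less.hyps)
      show "\<nu> \<in> partitions k" using \<nu> k by simp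
      have strip: "lookup \<nu> (Suc i) \<le> lookup \<mu> i" "lookup \<mu> i \<le> lookup \<nu> i" for i
        using \<nu> by (auto simp: horizontal_strip_def)
      show "\<nu> \<in> vectors (Suc r)"
        unfolding in_vectors_iff
      \<comment> \<open>Rows of \<mu> from \<open>r\<close> on are empty, so the strip condition
        lets \<nu> have at most one more row.\<close>
      proof (intro allI impI)
        fix i assume "Suc r \<le> i"
        then obtain j where "i = Suc j" "r \<le> j" by (cases i) auto
        then show "lookup \<nu> i = 0" using strip(1)[of j] by (simp add: lookup_\<mu>)
      qed
      \<comment> \<open>Otherwise \<nu> dominates \<alpha> entrywise and has the same weight, which
        forces \<nu> = \<alpha>.\<close>
      show "lookup \<nu> r < lookup \<alpha> r"
      proof (rule ccontr)
        assume "\<not> lookup \<nu> r < lookup \<alpha> r"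
        then have "lookup \<alpha> i \<le> lookup \<nu> i" for i
          using strip(2)[of i] less.prems(2)
          by (cases i r rule: linorder_cases) (auto simp: lookup_\<mu> in_vectors_iff)
        moreover have "weight \<alpha> = weight \<nu>"
          using \<nu> less.prems(1) k by (simp add: partitions_def)
        ultimately have "\<alpha> = \<nu>" by (rule composition_le_weight_eq)
        then show False using \<nu> by simp
      qed
    qed
    then obtain F where F: "\<And>\<nu>. \<nu> \<in> ?S - {\<alpha>} \<Longrightarrow> is_schur \<nu> (F \<nu>)" by metis
    \<comment> \<open>This solves the desired product rule for the one unknown term
      \<open>s_\<alpha>\<close>.\<close>
    define f where "f = complete_symmetric d * g - (\<Sum>\<nu>\<in>?S - {\<alpha>}. F \<nu>)"
    have "f \<in> symmetric_functions"
      unfolding f_def using g F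
      by (intro diff_symmetric mult_symmetric sum_symmetric complete_symmetric_symmetric)
        (auto simp: is_schur_def)
    moreover have "restrict_vars n f * ps_of_poly (alternant n (staircase n)) = schur_numerator n \<alpha>" for n
    proof -
      let ?a = "ps_of_poly (alternant n (staircase n))"
      have "restrict_vars n f * ?a = restrict_vars n (complete_symmetric d) * (restrict_vars n g * ?a) -
          (\<Sum>\<nu>\<in>?S - {\<alpha>}. restrict_vars n (F \<nu>) * ?a)"
        by (simp only: f_def restrict_vars_diff restrict_vars_mult restrict_vars_sum
            left_diff_distrib sum_distrib_right mult.assoc)
      also have "(\<Sum>\<nu>\<in>?S - {\<alpha>}. restrict_vars n (F \<nu>) * ?a) = (\<Sum>\<nu>\<in>?S - {\<alpha>}. schur_numerator n \<nu>)"
        using F by (intro sum.cong) (auto simp: is_schur_def)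
      also have "restrict_vars n g * ?a = schur_numerator n \<mu>"
        using g by (simp add: is_schur_def)
      also have "restrict_vars n (complete_symmetric d) * schur_numerator n \<mu> =
          (\<Sum>\<nu>\<in>?S. schur_numerator n \<nu>)"
        by (rule pieri_schur_numerator[OF \<mu>(1)])
      also have "\<dots> = schur_numerator n \<alpha> + (\<Sum>\<nu>\<in>?S - {\<alpha>}. schur_numerator n \<nu>)"
        by (rule sum.remove[OF fin \<alpha>S])
      finally show ?thesis by simp
    qed
    ultimately have "is_schur \<alpha> f" by (simp add: is_schur_def)
    then show ?case ..
  qed
qed

lemma is_schur_schur_partition:
  assumes "\<alpha> \<in> partitions k"
  shows "is_schur \<alpha> (schur \<alpha>)"
proof -
  obtain r where "\<alpha> \<in> vectors r" by (rule in_some_vectors)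
  then show ?thesis
    using is_schur_exists_vectors[OF assms] is_schur_schur by metis
qed

section \<open>Pieri's rule for Schur functions\<close>

theorem proposition2p5:
  fixes d n :: nat and \<mu> :: composition
  assumes "\<mu> \<in> partitions n"
  shows "complete_symmetric d * schur \<mu> =
    (\<Sum>\<nu>\<in>partitions (n + d). of_bool (horizontal_strip \<mu> \<nu>) * schur \<nu>)"
proof -
  let ?S = "{\<nu>. \<nu> \<in> partitions (n + d) \<and> horizontal_strip \<mu> \<nu>}"
  note \<mu> = is_schur_schur_partition[OF assms]
  have \<nu>: "is_schur \<nu> (schur \<nu>)" if "\<nu> \<in> ?S" for \<nu>
    using that is_schur_schur_partition by blast
  have "complete_symmetric d * schur \<mu> = (\<Sum>\<nu>\<in>?S. schur \<nu>)"
  \<comment> \<open>It suffices to compare both sides in each finite number of variables, after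
    multiplication by \<open>a_\<delta>\<close>.\<close>
  proof (rule restrict_vars_inject, rule restrict_vars_cancel_alternant)
    show "complete_symmetric d * schur \<mu> \<in> symmetric_functions" "(\<Sum>\<nu>\<in>?S. schur \<nu>) \<in> symmetric_functions"
      using \<mu> \<nu> by (auto intro!: mult_symmetric sum_symmetric complete_symmetric_symmetric
          simp: is_schur_def)
    fix m
    let ?a = "ps_of_poly (alternant m (staircase m))"
    have "restrict_vars m (complete_symmetric d * schur \<mu>) * ?a =
        restrict_vars m (complete_symmetric d) * schur_numerator m \<mu>"
      using \<mu> by (simp add: restrict_vars_mult mult.assoc is_schur_def)
    also have "\<dots> = (\<Sum>\<nu>\<in>?S. schur_numerator m \<nu>)"
      by (rule pieri_schur_numerator[OF assms])
    also have "\<dots> = (\<Sum>\<nu>\<in>?S. restrict_vars m (schur \<nu>) * ?a)"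
      using \<nu> by (intro sum.cong) (auto simp: is_schur_def)
    also have "\<dots> = restrict_vars m (\<Sum>\<nu>\<in>?S. schur \<nu>) * ?a"
      by (simp add: restrict_vars_sum sum_distrib_right)
    finally show "restrict_vars m (complete_symmetric d * schur \<mu>) * ?a =
      restrict_vars m (\<Sum>\<nu>\<in>?S. schur \<nu>) * ?a" .
  qed
  also have "\<dots> = (\<Sum>\<nu>\<in>partitions (n + d). of_bool (horizontal_strip \<mu> \<nu>) * schur \<nu>)"
    by (rule sum.mono_neutral_cong_left) (auto simp: finite_partitions)
  finally show ?thesis .
qed

end
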